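(* Let $\mathcal C$ be a coarse structure on a set $X$. Let $\mathcal{LSS}_X$ be the set of all families $\mathcal B$ of subsets of $X$ for which there is a controlled set $E\in\mathcal C$ such that $\bigcup_{B\in\mathcal B}B\times B\subset E$. Then $\mathcal{LSS}_X$ is a large scale structure on $X$.
   Context: For $B\subset X$ and a family $\mathcal U$ of subsets of $X$, the star $\mathrm{St}(B,\mathcal U)$ is the union of those elements of $\mathcal U$ that intersect $B$. For families $\mathcal B,\mathcal U$ of subsets of $X$, $\mathrm{St}(\mathcal B,\mathcal U)=\{\mathrm{St}(B,\mathcal U)\}_{B\in\mathcal B}$. A large scale structure $\mathcal{LSS}_X$ on a set $X$ is a non-empty set of families of subsets of $X$ (the uniformly bounded families) such that: (1) if $\mathcal B_1\in\mathcal{LSS}_X$ and $\mathcal B_2$ is a family of subsets of $X$ such that each element of $\mathcal B_2$ consisting of more than one point is contained in some element of $\mathcal B_1$, then $\mathcal B_2\in\mathcal{LSS}_X$; (2) $\mathcal B_1,\mathcal B_2\in\mathcal{LSS}_X$ implies $\mathrm{St}(\mathcal B_1,\mathcal B_2)\in\mathcal{LSS}_X$. A coarse structure $\mathcal C$ on $X$ is a family of subsets of $X\times X$ (called controlled sets) such that: (1) the diagonal $\Delta=\{(x,x)\}_{x\in X}$ belongs to $\mathcal C$; (2) $E_1\in\mathcal C$ and $E_2\subset E_1$ imply $E_2\in\mathcal C$; (3) $E\in\mathcal C$ implies $E^{-1}=\{(y,x)\mid(x,y)\in E\}\in\mathcal C$; (4) $E_1,E_2\in\mathcal C$ implies $E_1\cup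 E_2\in\mathcal C$; (5) $E,F\in\mathcal C$ implies $E\circ F\in\mathcal C$, where $E\circ F$ consists of all $(x,y)$ such that there is $z\in X$ with $(x,z)\in E$ and $(z,y)\in F$. *)

theory Defs
  imports Main
begin

definition star :: "'a set \<Rightarrow> 'a set set \<Rightarrow> 'a set" where
  "star B U = \<Union>{V \<in> U. V \<inter> B \<noteq> {}}"

definition star_family :: "'a set set \<Rightarrow> 'a set set \<Rightarrow> 'a set set" where
  "star_family \<B> U = (\<lambda>B. star B U) ` \<B>"

text \<open>The underlying set \<open>X\<close> is an explicit carrier, not a whole type, so the two structures below
  require their members to be families of subsets of \<open>X\<close> and subsets of \<open>X \<times> X\<close>, respectively.
  ``More than one point'' is spelled out because \<open>card\<close> is \<open>0\<close> on infinite sets.\<close>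

definition large_scale_structure :: "'a set \<Rightarrow> 'a set set set \<Rightarrow> bool" where
  "large_scale_structure X L \<longleftrightarrow>
     L \<subseteq> Pow (Pow X) \<and> L \<noteq> {} \<and>
     (\<forall>\<B>1 \<in> L. \<forall>\<B>2 \<subseteq> Pow X.
        (\<forall>B \<in> \<B>2. (\<exists>x \<in> B. \<exists>y \<in> B. x \<noteq> y) \<longrightarrow> (\<exists>A \<in> \<B>1. B \<subseteq> A)) \<longrightarrow> \<B>2 \<in> L) \<and>
     (\<forall>\<B>1 \<in> L. \<forall>\<B>2 \<in> L. star_family \<B>1 \<B>2 \<in> L)"

definition coarse_structure :: "'a set \<Rightarrow> ('a \<times> 'a) set set \<Rightarrow> bool" where
  "coarse_structure X C \<longleftrightarrow>
     C \<subseteq> Pow (X \<times> X) \<and>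
     Id_on X \<in> C \<and>
     (\<forall>E1 \<in> C. \<forall>E2 \<subseteq> E1. E2 \<in> C) \<and>
     (\<forall>E \<in> C. E\<inverse> \<in> C) \<and>
     (\<forall>E1 \<in> C. \<forall>E2 \<in> C. E1 \<union> E2 \<in> C) \<and>
     (\<forall>E \<in> C. \<forall>F \<in> C. E O F \<in> C)"

end

theory Submission
  imports Defs
begin

text \<open>A family is uniformly bounded when the relation "both points lie in a common member" is
  controlled, so each axiom reduces to bounding one such relation. Refining a family adds only
  diagonal pairs, coming from members with a single point; \<open>Un_squares_refinement\<close>
  absorbs them into \<open>Id_on X\<close>. Two points of one star are joined by a chain of three
  links, through a member of the second family, the starred set, and again a member of the second
  family; \<open>Un_squares_star_family\<close> turns this chain into a composition. Closure of
  \<open>C\<close> under unions and compositions does the rest.\<close>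

text \<open>An off-diagonal pair in \<open>B \<times> B\<close> shows that \<open>B\<close> has two
  points, so \<open>B\<close> lies in a member of \<open>\<B>1\<close> and the pair is in
  \<open>E\<close>.\<close>

lemma Un_squares_refinement:
  assumes "\<B>2 \<subseteq> Pow X"
    and "\<And>B. B \<in> \<B>2 \<Longrightarrow> \<exists>x \<in> B. \<exists>y \<in> B. x \<noteq> y \<Longrightarrow> \<exists>A \<in> \<B>1. B \<subseteq> A"
    and "(\<Union>B \<in> \<B>1. B \<times> B) \<subseteq> E"
  shows "(\<Union>B \<in> \<B>2. B \<times> B) \<subseteq> E \<union> Id_on X"
proof clarify
  fix x y B
  assume B: "B \<in> \<B>2" "x \<in> B" "y \<in> B" and "(x, y) \<notin> Id_on X"
  \<comment> \<open>Since \<open>B \<subseteq> X\<close>, equality would put the pair on the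
    diagonal of \<open>X\<close>.\<close>
  with assms(1) have "x \<noteq> y"
    by auto
  with B assms(2) obtain A where "A \<in> \<B>1" "B \<subseteq> A"
    by meson
  with B assms(3) show "(x, y) \<in> E"
    by blast
qed

text \<open>The points \<open>x\<close> and \<open>y\<close> lie in sets \<open>V\<close> and
  \<open>W\<close> of \<open>\<B>2\<close> that meet \<open>B\<close> at some \<open>p\<close> and
  \<open>q\<close>; the path \<open>x\<close>, \<open>p\<close>, \<open>q\<close>, \<open>y\<close>
  then has its links in \<open>F\<close>, \<open>E\<close>, \<open>F\<close>. Squares contain their
  pairs in both orders, so the same \<open>F\<close> serves at both ends.\<close>

lemma Un_squares_star_family:
  assumes E: "(\<Union>B \<in> \<B>1. B \<times> B) \<subseteq> E"
    and F: "(\<Union>B \<in> \<B>2. B \<times> B) \<subseteq> F"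
  shows "(\<Union>S \<in> star_family \<B>1 \<B>2. S \<times> S) \<subseteq> F O E O F"
proof clarify
  fix x y S
  assume "S \<in> star_family \<B>1 \<B>2" "x \<in> S" "y \<in> S"
  then obtain B where B: "B \<in> \<B>1" and "x \<in> star B \<B>2" "y \<in> star B \<B>2"
    by (auto simp: star_family_def)
  then obtain V W where V: "V \<in> \<B>2" "V \<inter> B \<noteq> {}" "x \<in> V" and W: "W \<in> \<B>2" "W \<inter> B \<noteq> {}" "y \<in> W"
    by (auto simp: star_def)
  then obtain p q where p: "p \<in> V" "p \<in> B" and q: "q \<in> W" "q \<in> B"
    by auto
  have "(x, p) \<in> F"
    using F V p by (auto dest: subsetD)
  moreover have "(p, q) \<in> E"
    using E B p q by (auto dest: subsetD)
  moreover have "(q, y) \<in> F"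
    using F W q by (auto dest: subsetD)
  ultimately show "(x, y) \<in> F O E O F"
    by blast
qed

theorem proposition2p5:
  fixes X :: "'a set" and C :: "('a \<times> 'a) set set"
  assumes "coarse_structure X C"
  shows "large_scale_structure X
           {\<B>. \<B> \<subseteq> Pow X \<and> (\<exists>E \<in> C. (\<Union>B \<in> \<B>. B \<times> B) \<subseteq> E)}"
    (is "large_scale_structure X ?L")
  unfolding large_scale_structure_def
proof (intro conjI ballI allI impI)
  have Id: "Id_on X \<in> C"
    and Un: "\<forall>E \<in> C. \<forall>F \<in> C. E \<union> F \<in> C"
    and comp: "\<forall>E \<in> C. \<forall>F \<in> C. E O F \<in> C"
    using assms unfolding coarse_structure_def by - (elim conjE, assumption)+
  show "?L \<subseteq> Pow (Pow X)"
    by blast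
  \<comment> \<open>The empty family has an empty union of squares, which lies in the controlled set
    \<open>Id_on X\<close>.\<close>
  have "{} \<in> ?L"
    using Id by blast
  then show "?L \<noteq> {}"
    by blast
  show "\<B>2 \<in> ?L"
    if \<B>1: "\<B>1 \<in> ?L" and \<B>2: "\<B>2 \<subseteq> Pow X"
      and refines: "\<forall>B \<in> \<B>2. (\<exists>x \<in> B. \<exists>y \<in> B. x \<noteq> y) \<longrightarrow> (\<exists>A \<in> \<B>1. B \<subseteq> A)"
    for \<B>1 \<B>2
  proof -
    from \<B>1[THEN CollectD, THEN conjunct2]
    obtain E where "E \<in> C" and E: "(\<Union>B \<in> \<B>1. B \<times> B) \<subseteq> E" ..
    have "(\<Union>B \<in> \<B>2. B \<times> B) \<subseteq> E \<union> Id_on X"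
      by (rule Un_squares_refinement[OF \<B>2 _ E]) (rule refines[rule_format])
    then have "\<exists>E' \<in> C. (\<Union>B \<in> \<B>2. B \<times> B) \<subseteq> E'"
      using Un[rule_format, OF \<open>E \<in> C\<close> Id] by (rule bexI)
    with \<B>2 show ?thesis
      by simp
  qed
  show "star_family \<B>1 \<B>2 \<in> ?L" if \<B>1: "\<B>1 \<in> ?L" and \<B>2: "\<B>2 \<in> ?L" for \<B>1 \<B>2
  proof -
    from \<B>1[THEN CollectD, THEN conjunct2]
    obtain E where "E \<in> C" and E: "(\<Union>B \<in> \<B>1. B \<times> B) \<subseteq> E" ..
    from \<B>2[THEN CollectD, THEN conjunct2]
    obtain F where "F \<in> C" and F: "(\<Union>B \<in> \<B>2. B \<times> B) \<subseteq> F" ..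
    have "F O E O F \<in> C"
      using \<open>E \<in> C\<close> \<open>F \<in> C\<close> comp by simp
    with Un_squares_star_family[OF E F]
    have "\<exists>E' \<in> C. (\<Union>S \<in> star_family \<B>1 \<B>2. S \<times> S) \<subseteq> E'"
      by (rule bexI)
    moreover from \<B>2 have "\<B>2 \<subseteq> Pow X"
      by simp
    \<comment> \<open>Each star is a union of members of \<open>\<B>2\<close>, hence a subset of
      \<open>X\<close>.\<close>
    then have "star_family \<B>1 \<B>2 \<subseteq> Pow X"
      by (auto simp: star_family_def star_def)
    ultimately show ?thesis
      by simp
  qed
qed

end
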